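(* Let $W\ge 1$ be an integer and let $0\le\epsilon\le\frac14$. Any deterministic algorithm that provides a $W\epsilon$-additive approximation for the Basic-Counting problem with window size $W$ requires at least $$\left\lfloor \max\left\{\log W,\ \frac{1}{2\epsilon+W^{-1}}\right\}\right\rfloor$$ bits of memory.
   Context: All logarithms are base 2. Basic-Counting: given a stream of bits arriving one at a time and a window size $W$, maintain $C^W$, the number of 1's among the last $W$ bits of the stream (if fewer than $W$ bits have arrived, among all bits so far). A deterministic algorithm using $m$ bits of memory ($m$ a nonnegative integer) has at most $2^m$ memory configurations, a fixed initial configuration, and a deterministic transition of configuration upon each arriving bit; when queried it outputs a real number determined by its current configuration. It provides a $W\epsilon$-additive approximation for Basic-Counting if for every input stream and at every time the query answer $\widehat{C^W}$ satisfies $|C^W-\widehat{C^W}|\le W\epsilon$. *)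

theory Defs
  imports Complex_Main
begin

record 'c streaming_alg =
  configs :: "'c set"
  init :: 'c
  step :: "'c \<Rightarrow> bool \<Rightarrow> 'c"
  query :: "'c \<Rightarrow> real"

definition streaming_algorithm :: "'c streaming_alg \<Rightarrow> bool" where
  "streaming_algorithm A \<longleftrightarrow>
     init A \<in> configs A \<and> (\<forall>c \<in> configs A. \<forall>b. step A c b \<in> configs A)"

(* The finiteness conjunct matters: card of an infinite set is 0. *)
definition uses_bits :: "'c streaming_alg \<Rightarrow> nat \<Rightarrow> bool" where
  "uses_bits A m \<longleftrightarrow> finite (configs A) \<and> card (configs A) \<le> 2 ^ m"

(* Streams are infinite; the bits that have arrived by time t are s 0, ..., s (t - 1). *)
primrec config_at :: "'c streaming_alg \<Rightarrow> (nat \<Rightarrow> bool) \<Rightarrow> nat \<Rightarrow> 'c" where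
  "config_at A s 0 = init A"
| "config_at A s (Suc t) = step A (config_at A s t) (s t)"

(* For t < W the truncated subtraction t - W is 0, so all bits so far are counted. *)
definition window_count :: "nat \<Rightarrow> (nat \<Rightarrow> bool) \<Rightarrow> nat \<Rightarrow> nat" where
  "window_count W s t = card {i \<in> {t - W..<t}. s i}"

definition additive_approx_basic_counting ::
    "'c streaming_alg \<Rightarrow> nat \<Rightarrow> real \<Rightarrow> bool" where
  "additive_approx_basic_counting A W \<epsilon> \<longleftrightarrow>
     (\<forall>s t. \<bar>real (window_count W s t) - query A (config_at A s t)\<bar> \<le> real W * \<epsilon>)"

end

(* Two streams that lead to the same configuration have window counts within 2 W eps of each other.
   For the logarithmic bound, feed W ones and then zeros: among the first card (configs A) + 1
   configurations of the zero phase two coincide, so the first of these recurs forever and is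
   also reached with an empty window; as at most card (configs A) - 1 zeros precede its first
   occurrence, this forces W < 2 * card (configs A).
   For the linear bound, put d = floor(2 W eps) + 1 and encode a set of block indices below L, with
   L d <= W, as L constant blocks of length d. If two sets led to the same configuration, then
   padding with zeros until the window starts at the last block in which they differ would make
   the two window counts differ by exactly d > 2 W eps. *)
theory Submission
  imports Defs
begin

lemma config_at_in_configs:
  assumes "streaming_algorithm A"
  shows "config_at A s t \<in> configs A"
  using assms by (induction t) (auto simp: streaming_algorithm_def)

lemma config_at_same_continuation:
  assumes "config_at A s t = config_at A s' t'"
    and "\<And>k. s (t + k) = s' (t' + k)"
  shows "config_at A s (t + n) = config_at A s' (t' + n)"
  using assms by (induction n) auto

text \<open>The query sees only the configuration, so both counts lie within
  \<open>W * \<epsilon>\<close> of one and the same answer.\<close>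

lemma window_count_diff_le:
  assumes "additive_approx_basic_counting A W \<epsilon>"
    and "config_at A s t = config_at A s' t'"
  shows "real (window_count W s t) - real (window_count W s' t') \<le> 2 * (real W * \<epsilon>)"
proof -
  have "\<bar>real (window_count W s t) - query A (config_at A s t)\<bar> \<le> real W * \<epsilon>"
    and "\<bar>real (window_count W s' t') - query A (config_at A s' t')\<bar> \<le> real W * \<epsilon>"
    using assms(1) unfolding additive_approx_basic_counting_def by blast+
  then show ?thesis
    using assms(2) by auto
qed

lemma window_lt_twice_card_configs:
  assumes "W \<ge> 1" and "\<epsilon> \<le> 1/4"
    and "streaming_algorithm A" and fin: "finite (configs A)"
    and approx: "additive_approx_basic_counting A W \<epsilon>"
  shows "W < 2 * card (configs A)"
proof (cases "card (configs A) \<le> W")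
  case True
  define s where "s n \<longleftrightarrow> n < W" for n
  define c where "c i = config_at A s (W + i)" for i
  have "c ` {..card (configs A)} \<subseteq> configs A"
    using config_at_in_configs[OF assms(3)] by (auto simp: c_def)
  then have "card (c ` {..card (configs A)}) < card {..card (configs A)}"
    using card_mono[OF fin] by (simp add: le_imp_less_Suc)
  then have "\<not> inj_on c {..card (configs A)}"
    by (rule pigeonhole)
  then obtain i j where ij: "i < j" "j \<le> card (configs A)" "c i = c j"
    unfolding inj_on_def by (metis atMost_iff linorder_neqE_nat)
  \<comment> \<open>From time \<open>W\<close> on all bits of \<open>s\<close> are zero, so
    \<open>j - i\<close> further bits lead from any recurrence of \<open>c i\<close> to
    \<open>c j\<close>, which is \<open>c i\<close> again.\<close>
  have periodic: "c (i + k * (j - i)) = c i" for k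
  proof (induction k)
    case (Suc k)
    have "config_at A s (W + (i + k * (j - i)) + (j - i)) = config_at A s (W + i + (j - i))"
      using Suc by (intro config_at_same_continuation) (auto simp: c_def s_def)
    moreover have "W + (i + Suc k * (j - i)) = W + (i + k * (j - i)) + (j - i)"
      by simp
    moreover have "c j = config_at A s (W + i + (j - i))"
      using ij(1) by (simp add: c_def)
    ultimately show ?case
      using ij(3) by (simp only: c_def)
  qed simp
  have "{n \<in> {W + i - W..<W + i}. s n} = {i..<W}"
    by (auto simp: s_def)
  then have full: "window_count W s (W + i) = W - i"
    by (simp add: window_count_def)
  \<comment> \<open>Since \<open>j - i\<close> is at least 1, \<open>W\<close> rounds of the cycle
    suffice to move the window past all the ones.\<close>
  have "W \<le> i + W * (j - i)"
    using ij(1) by (intro trans_le_add2) (simp add: Suc_le_eq)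
  then have empty: "window_count W s (W + (i + W * (j - i))) = 0"
    by (auto simp: window_count_def s_def)
  have "real (W - i) \<le> 2 * (real W * \<epsilon>)"
    using window_count_diff_le[OF approx, of s "W + i" s "W + (i + W * (j - i))"]
      periodic[of W] full empty by (simp add: c_def)
  also have "\<dots> \<le> real W / 2"
    using mult_left_mono[OF assms(2), of "real W"] by simp
  \<comment> \<open>Here \<open>i < j \<le> card (configs A) \<le> W\<close>, so the truncated
    \<open>W - i\<close> is a true difference.\<close>
  finally have "W \<le> 2 * i"
    using ij True by (simp add: of_nat_diff)
  then show ?thesis
    using ij by simp
qed (use assms(1) in auto)

lemma two_power_blocks_le_card_configs:
  assumes "streaming_algorithm A" and fin: "finite (configs A)"
    and approx: "additive_approx_basic_counting A W \<epsilon>"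
    and d: "2 * (real W * \<epsilon>) < real d" and "L * d \<le> W" and "0 < d"
  shows "2 ^ L \<le> card (configs A)"
proof -
  \<comment> \<open>The bound \<open>n < L * d\<close> makes every stream zero after its blocks, so
    that all of them continue alike.\<close>
  define stream where "stream S n \<longleftrightarrow> n < L * d \<and> n div d \<in> S" for S n
  have separated: "config_at A (stream S) (L * d) \<noteq> config_at A (stream T) (L * d)"
    if i: "i < L" "i \<in> S" "i \<notin> T"
      and later: "\<And>k. \<lbrakk>i < k; k < L\<rbrakk> \<Longrightarrow> k \<in> S \<longleftrightarrow> k \<in> T" for S T i
  proof
    assume "config_at A (stream S) (L * d) = config_at A (stream T) (L * d)"
    then have "config_at A (stream S) (L * d + n) = config_at A (stream T) (L * d + n)" for n
      by (rule config_at_same_continuation) (simp add: stream_def)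
    \<comment> \<open>This much padding makes the window start at \<open>i * d\<close>, the left end
      of block \<open>i\<close>; by \<open>L * d \<le> W\<close> the subtraction does not
      truncate.\<close>
    from this[of "W + i * d - L * d"]
    have same: "config_at A (stream S) (W + i * d) = config_at A (stream T) (W + i * d)"
      using assms(5) by simp
    have block: "n div d = i \<longleftrightarrow> i * d \<le> n \<and> n < i * d + d" for n
      using \<open>0 < d\<close> dividend_less_div_times[of d n]
      by (auto simp: div_nat_eqI algebra_simps)
    have block_end: "i * d + d \<le> L * d"
      using mult_le_mono1[of "Suc i" L d] i(1) by simp
    let ?I = "{W + i * d - W..<W + i * d}"
    have "stream S n \<longleftrightarrow> stream T n \<or> n \<in> {i * d..<i * d + d}" if "i * d \<le> n" for n
    proof -
      have "i \<le> n div d"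
        using div_le_mono[OF that, of d] \<open>0 < d\<close> by simp
      moreover have "n div d < L" if "n < L * d"
        using that by (simp add: less_mult_imp_div_less)
      ultimately show ?thesis
        using block[of n] block_end later[of "n div d"] i
        by (cases "n div d = i") (auto simp: stream_def)
    qed
    \<comment> \<open>Block \<open>i\<close> ends by \<open>L * d \<le> W\<close>, hence lies wholly
      inside the window.\<close>
    then have "{n \<in> ?I. stream S n} = {n \<in> ?I. stream T n} \<union> {i * d..<i * d + d}"
      using block_end assms(5) by auto
    moreover have "\<not> stream T n" if "n \<in> {i * d..<i * d + d}" for n
      using that block[of n] i(3) by (auto simp: stream_def)
    then have "{n \<in> ?I. stream T n} \<inter> {i * d..<i * d + d} = {}"
      by blast
    ultimately have "window_count W (stream S) (W + i * d)
        = window_count W (stream T) (W + i * d) + d"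
      unfolding window_count_def by (simp add: card_Un_disjoint)
    then show False
      using window_count_diff_le[OF approx same] d by simp
  qed
  have "inj_on (\<lambda>S. config_at A (stream S) (L * d)) (Pow {..<L})"
  proof (rule inj_onI, rule ccontr)
    fix S T
    assume ST: "S \<in> Pow {..<L}" "T \<in> Pow {..<L}"
      and eq: "config_at A (stream S) (L * d) = config_at A (stream T) (L * d)" and "S \<noteq> T"
    \<comment> \<open>The last differing block may belong to either set, so \<open>separated\<close>
      is applied in both orders at \<open>Max D\<close>.\<close>
    define D where "D = (S - T) \<union> (T - S)"
    have D: "finite D" "D \<noteq> {}" "D \<subseteq> {..<L}"
      using ST \<open>S \<noteq> T\<close> by (auto simp: D_def intro: finite_subset[of _ "{..<L}"])
    have later: "k \<in> S \<longleftrightarrow> k \<in> T" if "Max D < k" for k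
      using that Max_ge[OF D(1), of k] by (auto simp: D_def)
    have "Max D \<in> D"
      using D by simp
    then show False
      using separated[of "Max D" S T] separated[of "Max D" T S] D(3) eq later
      by (auto simp: D_def)
  qed
  then have "card (Pow {..<L}) \<le> card (configs A)"
    by (rule card_inj_on_le) (use config_at_in_configs[OF assms(1)] fin in auto)
  then show ?thesis
    by (simp add: card_Pow)
qed

theorem theorem5:
  fixes A :: "'c streaming_alg" and W m :: nat and \<epsilon> :: real
  assumes "W \<ge> 1"
    and "0 \<le> \<epsilon>" and "\<epsilon> \<le> 1/4"
    and "streaming_algorithm A"
    and "uses_bits A m"
    and "additive_approx_basic_counting A W \<epsilon>"
  shows "\<lfloor>max (log 2 (real W)) (1 / (2 * \<epsilon> + inverse (real W)))\<rfloor> \<le> int m"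
proof -
  have fin: "finite (configs A)" and card: "card (configs A) \<le> 2 ^ m"
    using assms(5) by (auto simp: uses_bits_def)
  have "W < 2 ^ Suc m"
    using window_lt_twice_card_configs[OF assms(1,3,4) fin assms(6)] card by simp
  then have "real W < 2 ^ Suc m"
    using of_nat_less_iff[of W "2 ^ Suc m", where 'a = real] by simp
  then have log: "log 2 (real W) < real m + 1"
    using assms(1) by (simp add: log_less_iff powr_add powr_realpow)

  let ?x = "1 / (2 * \<epsilon> + inverse (real W))"
  \<comment> \<open>\<open>d\<close> is the least natural number exceeding
    \<open>2 * (real W * \<epsilon>)\<close>. As \<open>?x\<close> equals
    \<open>W / (2 * W * \<epsilon> + 1)\<close> and \<open>d\<close> is at most that denominator,
    \<open>L\<close> blocks fit into \<open>W\<close> bits.\<close>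
  define d where "d = nat \<lfloor>2 * (real W * \<epsilon>)\<rfloor> + 1"
  define L where "L = nat \<lfloor>?x\<rfloor>"
  have nonneg: "0 \<le> 2 * (real W * \<epsilon>)" "0 \<le> ?x"
    using assms(2) by simp_all
  have d: "2 * (real W * \<epsilon>) < real d" "real d \<le> 2 * (real W * \<epsilon>) + 1"
    using nonneg(1) unfolding d_def by linarith+
  have "real L \<le> ?x"
    using nonneg(2) by (simp add: L_def)
  then have "real L * real d \<le> ?x * (2 * (real W * \<epsilon>) + 1)"
    using d(2) nonneg by (intro mult_mono) auto
  also have "2 * (real W * \<epsilon>) + 1 = real W * (2 * \<epsilon> + inverse (real W))"
    using assms(1) by (simp add: field_simps)
  also have "?x * \<dots> = real W"
  proof -
    have "0 < inverse (real W)"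
      using assms(1) by simp
    then have "2 * \<epsilon> + inverse (real W) \<noteq> 0"
      using assms(2) by linarith
    then show ?thesis
      by simp
  qed
  finally have "L * d \<le> W"
    by (simp flip: of_nat_mult)
  then have "2 ^ L \<le> card (configs A)"
    by (intro two_power_blocks_le_card_configs[OF assms(4) fin assms(6) d(1)]) (auto simp: d_def)
  also note card
  \<comment> \<open>\<open>2 ^ L \<le> 2 ^ m\<close> gives \<open>L \<le> m\<close>; undoing the
    floor puts this bound in the same form as \<open>log\<close>.\<close>
  finally have "?x < real m + 1"
    using nonneg(2) unfolding L_def by (simp add: nat_le_iff floor_le_iff)
  then show ?thesis
    using log by (simp add: floor_le_iff)
qed

end
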